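(* Let $p$ be a positive integer. Then for every real or complex number $x$, $$M(x,p) = e^x \varphi_p(x) + e^x\int_0^x \varphi_p(t)\,dt = e^x\sum_{k=0}^{p} S(p,k)\left(x^k+\frac{x^{k+1}}{k+1}\right),$$ where $M(x,p)=\sum_{n=1}^{\infty}\left(1^p+2^p+\dots+n^p\right)\frac{x^n}{n!}$.
   Context: $S(m,k)$ denotes the Stirling numbers of the second kind. The exponential polynomials are $\varphi_m(x)=\sum_{k=0}^{m} S(m,k)x^k$ for integers $m\ge 0$. For complex $x$ the integral is taken along the line segment from $0$ to $x$. *)

theory Defs
  imports "HOL-Complex_Analysis.Complex_Analysis" "HOL-Combinatorics.Stirling"
begin

definition exp_poly :: "nat \<Rightarrow> 'a::comm_semiring_1 \<Rightarrow> 'a" where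
  "exp_poly m x = (\<Sum>k=0..m. of_nat (Stirling m k) * x ^ k)"

(* The index is shifted, n = Suc i, so that the series starts at n = 1. *)
definition power_sum_term :: "'a::real_normed_field \<Rightarrow> nat \<Rightarrow> nat \<Rightarrow> 'a" where
  "power_sum_term x p i = (\<Sum>j=1..Suc i. of_nat j ^ p) * (x ^ Suc i / fact (Suc i))"

definition M :: "'a::{real_normed_field,banach} \<Rightarrow> nat \<Rightarrow> 'a" where
  "M x p = (\<Sum>i. power_sum_term x p i)"

end

(* Expanding j^p in falling factorials with the Stirling numbers and applying the hockey-stick
   identity gives 1^p + ... + n^p = \<Sum>k. S(p,k) k! C(n+1,k+1).  By Pascal's rule
   k! C(n+1,k+1) / n! is the sum of 1/(n-k)! and 1/((k+1) (n-k-1)!), so the generating series is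
   a combination of shifted exponential series. *)

theory Submission
  imports Defs
begin

text \<open>Induction on \<open>p\<close>: writing \<open>n = k + (n - k)\<close> turns
  multiplication by \<open>n\<close> into the recurrence
  \<open>S(p+1,k+1) = (k+1) S(p,k+1) + S(p,k)\<close>.\<close>

lemma power_eq_sum_Stirling:
  fixes n p :: nat
  shows "n ^ p = (\<Sum>k\<le>p. Stirling p k * (fact k * (n choose k)))"
proof (induction p)
  case 0
  show ?case by simp
next
  case (Suc p)
  \<comment> \<open>\<open>a k\<close> is the falling factorial \<open>n (n-1) ... (n-k+1)\<close>,
    which vanishes for \<open>k > n\<close>.\<close>
  define a where "a = (\<lambda>k. fact k * (n choose k))"
  have "n * (n choose k) = k * (n choose k) + Suc k * (n choose Suc k)" for k
  proof (cases "k \<le> n")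
    case True
    have "n * (n choose k) = k * (n choose k) + (n - k) * (n choose k)"
      using True by (simp flip: distrib_right)
    then show ?thesis
      by (simp only: binomial_absorb_comp binomial_absorption)
  qed (simp add: binomial_eq_0)
  then have a: "n * a k = k * a k + a (Suc k)" for k
    unfolding a_def mult.left_commute[of n] by (simp add: algebra_simps)
  have "n ^ Suc p = (\<Sum>k\<le>p. Stirling p k * (n * a k))"
    by (simp add: Suc a_def sum_distrib_left mult_ac)
  \<comment> \<open>The first sum may run up to \<open>Suc p\<close> since
    \<open>Stirling p (Suc p) = 0\<close>; its \<open>k = 0\<close> term is zero, so shifting its
    index aligns it with the second.\<close>
  also have "\<dots> = (\<Sum>k\<le>Suc p. Stirling p k * (k * a k)) + (\<Sum>k\<le>p. Stirling p k * a (Suc k))"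
    by (simp add: a distrib_left sum.distrib)
  also have "\<dots> = (\<Sum>k\<le>p. Stirling (Suc p) (Suc k) * a (Suc k))"
    by (subst sum.atMost_Suc_shift) (simp add: algebra_simps flip: sum.distrib)
  also have "\<dots> = (\<Sum>k\<le>Suc p. Stirling (Suc p) k * a k)"
    by (subst sum.atMost_Suc_shift) simp
  finally show ?case
    unfolding a_def .
qed

lemma sum_powers_eq_sum_Stirling:
  fixes n p :: nat
  assumes "p \<ge> 1"
  shows "(\<Sum>j=1..n. j ^ p) = (\<Sum>k\<le>p. Stirling p k * (fact k * (Suc n choose Suc k)))"
proof -
  have "(\<Sum>j=1..n. j ^ p) = (\<Sum>j\<le>n. j ^ p)"
    \<comment> \<open>The added term \<open>j = 0\<close> is \<open>0 ^ p = 0\<close> because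
      \<open>p \<ge> 1\<close>.\<close>
    using assms by (intro sum.mono_neutral_left) auto
  also have "\<dots> = (\<Sum>k\<le>p. \<Sum>j\<le>n. Stirling p k * (fact k * (j choose k)))"
    by (subst power_eq_sum_Stirling) (rule sum.swap)
  also have "\<dots> = (\<Sum>k\<le>p. Stirling p k * (fact k * (Suc n choose Suc k)))"
    by (simp only: sum_distrib_left[symmetric] sum_choose_upper)
  finally show ?thesis .
qed

text \<open>The terms with \<open>n < k\<close> vanish, and replacing \<open>n\<close> by
  \<open>n + k\<close> gives \<open>C(n+k,k) / (n+k)! = 1 / (k! n!)\<close>, which leaves a multiple
  of the exponential series.\<close>

lemma sums_choose_exp:
  fixes x :: "'a::{real_normed_field,banach}"
  shows "(\<lambda>n. of_nat (n choose k) * (x ^ n / fact n)) sums (x ^ k / fact k * exp x)"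
proof -
  have term_shift: "of_nat (n + k choose k) * (x ^ (n + k) / fact (n + k)) = x ^ k / fact k * (x ^ n /\<^sub>R fact n)" for n
    by (simp add: binomial_fact power_add scaleR_conv_of_real field_simps)
  have "(\<lambda>n. of_nat (n + k choose k) * (x ^ (n + k) / fact (n + k))) sums (x ^ k / fact k * exp x)"
    unfolding term_shift by (intro sums_mult exp_converges)
  then show ?thesis
    by (subst (asm) sums_iff_shift) (simp add: binomial_eq_0)
qed

lemma power_sum_term_sums:
  fixes x :: "'a::{real_normed_field,banach}"
  assumes "p \<ge> 1"
  shows "power_sum_term x p sums
    (exp x * (\<Sum>k=0..p. of_nat (Stirling p k) * (x ^ k + x ^ (k + 1) / of_nat (k + 1))))"
proof -
  \<comment> \<open>Unlike \<open>power_sum_term\<close>, \<open>f\<close> starts at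
    \<open>n = 0\<close>, where the inner sum is empty; since \<open>f 0 = 0\<close>, the final
    shift to \<open>Suc i\<close> keeps the value.\<close>
  define f where "f = (\<lambda>n. (\<Sum>j=1..n. of_nat j ^ p) * (x ^ n / fact n))"
  have f_eq: "f n = (\<Sum>k\<le>p. of_nat (Stirling p k) * (fact k *
      (of_nat (n choose k) * (x ^ n / fact n) + of_nat (n choose Suc k) * (x ^ n / fact n))))" for n
  proof -
    have "(\<Sum>j=1..n. of_nat j ^ p) = (of_nat (\<Sum>j=1..n. j ^ p) :: 'a)"
      by simp
    \<comment> \<open>Pascal's rule splits \<open>Suc n choose Suc k\<close>, so that
      \<open>sums_choose_exp\<close> applies to each part.\<close>
    also have "\<dots> = (\<Sum>k\<le>p. of_nat (Stirling p k) *
        (fact k * (of_nat (n choose k) + of_nat (n choose Suc k))))"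
      unfolding sum_powers_eq_sum_Stirling[OF assms] by simp
    finally have powers: "(\<Sum>j=1..n. of_nat j ^ p) = \<dots>" .
    show ?thesis
      unfolding f_def powers by (simp only: sum_distrib_right distrib_right mult.assoc)
  qed
  have "f sums (\<Sum>k\<le>p. of_nat (Stirling p k) * (fact k *
      (x ^ k / fact k * exp x + x ^ Suc k / fact (Suc k) * exp x)))"
    unfolding f_eq by (intro sums_sum sums_mult sums_add sums_choose_exp)
  also have "(\<Sum>k\<le>p. of_nat (Stirling p k) * (fact k *
      (x ^ k / fact k * exp x + x ^ Suc k / fact (Suc k) * exp x))) =
    exp x * (\<Sum>k=0..p. of_nat (Stirling p k) * (x ^ k + x ^ (k + 1) / of_nat (k + 1)))"
    unfolding sum_distrib_left atLeast0AtMost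
  proof (intro sum.cong refl)
    fix k
    have "fact k * (x ^ k / fact k * exp x + x ^ Suc k / fact (Suc k) * exp x) =
        exp x * (x ^ k + x ^ (k + 1) / of_nat (k + 1))"
      by (simp add: fact_Suc distrib_left mult_ac del: of_nat_Suc)
    then show "of_nat (Stirling p k) * (fact k *
        (x ^ k / fact k * exp x + x ^ Suc k / fact (Suc k) * exp x)) =
      exp x * (of_nat (Stirling p k) * (x ^ k + x ^ (k + 1) / of_nat (k + 1)))"
      by (simp only: mult.left_commute)
  qed
  finally have "(\<lambda>i. f (Suc i)) sums
    (exp x * (\<Sum>k=0..p. of_nat (Stirling p k) * (x ^ k + x ^ (k + 1) / of_nat (k + 1))))"
    by (subst sums_Suc_iff) (simp add: f_def)
  then show ?thesis
    by (simp add: f_def power_sum_term_def[abs_def])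
qed

text \<open>The common value of the complex and the real integral of \<open>exp_poly m\<close> from
  0 to \<open>x\<close>, available in any normed field.\<close>

definition exp_poly_primitive :: "nat \<Rightarrow> 'a::real_normed_field \<Rightarrow> 'a" where
  "exp_poly_primitive m x = (\<Sum>k=0..m. of_nat (Stirling m k) * (x ^ (k + 1) / of_nat (k + 1)))"

lemma exp_poly_primitive_0 [simp]: "exp_poly_primitive m 0 = 0"
  by (simp add: exp_poly_primitive_def)

lemma has_field_derivative_exp_poly_primitive:
  "(exp_poly_primitive m has_field_derivative exp_poly m x) (at x within S)"
  unfolding exp_poly_primitive_def[abs_def] exp_poly_def
  by (rule derivative_eq_intros refl | simp add: mult.commute del: of_nat_Suc)+

lemma exp_poly_add_primitive:
  "exp_poly m x + exp_poly_primitive m x =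
    (\<Sum>k=0..m. of_nat (Stirling m k) * (x ^ k + x ^ (k + 1) / of_nat (k + 1)))"
  by (simp add: exp_poly_def exp_poly_primitive_def distrib_left sum.distrib)

text \<open>The primitive is valid on the whole plane, so only the endpoints count, and it vanishes
  at 0.\<close>

lemma contour_integral_linepath_exp_poly:
  "contour_integral (linepath 0 x) (exp_poly m) = exp_poly_primitive m x"
  using contour_integral_primitive[where S = UNIV and g = "linepath 0 x",
      OF has_field_derivative_exp_poly_primitive[of m]]
  by (simp add: contour_integral_unique)

lemma interval_integral_exp_poly:
  fixes x :: real
  shows "(LBINT t=ereal 0..ereal x. exp_poly m t) = exp_poly_primitive m x"
proof -
  have "(LBINT t=ereal 0..ereal x. exp_poly m t) = exp_poly_primitive m x - exp_poly_primitive m 0"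
  proof (rule interval_integral_FTC_finite)
    show "continuous_on {min 0 x..max 0 x} (exp_poly m)"
      unfolding exp_poly_def[abs_def] by (intro continuous_intros)
  qed (use has_field_derivative_exp_poly_primitive in
      \<open>simp add: has_real_derivative_iff_has_vector_derivative[symmetric]\<close>)
  then show ?thesis by simp
qed

text \<open>With the primitive in place of the integral, one statement covers both the real and the
  complex case.\<close>

lemma M_eq_exp_poly:
  fixes x :: "'a::{real_normed_field,banach}"
  assumes "p \<ge> 1"
  shows "summable (power_sum_term x p) \<and>
    M x p = exp x * exp_poly p x + exp x * exp_poly_primitive p x \<and>
    exp x * exp_poly p x + exp x * exp_poly_primitive p x =
      exp x * (\<Sum>k=0..p. of_nat (Stirling p k) * (x ^ k + x ^ (k + 1) / of_nat (k + 1)))"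
  using power_sum_term_sums[OF assms, of x]
  unfolding M_def sums_iff distrib_left[of "exp x", symmetric] exp_poly_add_primitive by simp

theorem mainTheorem2:
  fixes p :: nat
  assumes "p \<ge> 1"
  shows
    "(\<forall>x::complex.
        summable (power_sum_term x p) \<and>
        M x p = exp x * exp_poly p x + exp x * contour_integral (linepath 0 x) (exp_poly p) \<and>
        exp x * exp_poly p x + exp x * contour_integral (linepath 0 x) (exp_poly p) =
          exp x * (\<Sum>k=0..p. of_nat (Stirling p k) * (x ^ k + x ^ (k + 1) / of_nat (k + 1)))) \<and>
     (\<forall>x::real.
        summable (power_sum_term x p) \<and>
        M x p = exp x * exp_poly p x + exp x * (LBINT t=ereal 0..ereal x. exp_poly p t) \<and>
        exp x * exp_poly p x + exp x * (LBINT t=ereal 0..ereal x. exp_poly p t) =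
          exp x * (\<Sum>k=0..p. of_nat (Stirling p k) * (x ^ k + x ^ (k + 1) / of_nat (k + 1))))"
  unfolding contour_integral_linepath_exp_poly interval_integral_exp_poly
  \<comment> \<open>The instantiated \<open>conjI\<close> splits only the outer conjunction, so that
    each inner one still matches \<open>M_eq_exp_poly\<close>.\<close>
  by (intro conjI[of "All _"] allI M_eq_exp_poly assms)

end
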